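(* For all integers $k\ge 0$, $$\sum_{\mu} a_k(\mu)\, s_\mu(\boldsymbol{x})=\sum_{j\ge 0} S(k,j)\, h_1(\boldsymbol{x})^j,$$ where the sum on the left is over all integer partitions $\mu$.
   Context: Integer partitions are identified with their Young diagrams and ordered by containment; $\emptyset$ is the only partition of $0$. A limiting vacillating tableau of shape $\mu$ and length $2k$ is a sequence of integer partitions $(\mu^{(0)}=\emptyset,\mu^{(1/2)},\mu^{(1)},\dots,\mu^{(k-1/2)},\mu^{(k)}=\mu)$ such that for each integer $j=0,\dots,k-1$: (a) $\mu^{(j)}\supseteq\mu^{(j+1/2)}$ and $|\mu^{(j)}/\mu^{(j+1/2)}|\in\{0,1\}$; (b) $\mu^{(j+1/2)}\subseteq\mu^{(j+1)}$ and $|\mu^{(j+1)}/\mu^{(j+1/2)}|=1$. $a_k(\mu)$ is the number of limiting vacillating tableaux of shape $\mu$ and length $2k$. $s_\mu(\boldsymbol{x})$ is the Schur function in $\boldsymbol{x}=(x_1,x_2,\dots)$, with $s_\emptyset=1$; $h_1(\boldsymbol{x})=\sum_i x_i$. $S(k,j)$ is the Stirling number of the second kind, with $S(0,0)=1$ and $S(0,j)=0$ for $j\ge1$. *)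

theory Defs
  imports
    Main
    "HOL-Library.Poly_Mapping"
    "HOL-Library.FuncSet"
    "HOL-Combinatorics.Stirling"
begin

section \<open>Integer partitions and Young diagrams\<close>

typedef integer_partition = "{xs :: nat list. sorted_wrt (\<ge>) xs \<and> 0 \<notin> set xs}"
  morphisms parts Abs_integer_partition
  by (rule exI[of _ "[]"]) simp

setup_lifting type_definition_integer_partition

lift_definition empty_partition :: integer_partition is "[] :: nat list"
  by simp

text \<open>Cells are pairs (row, column), both counted from 0.\<close>

definition diagram :: "integer_partition \<Rightarrow> (nat \<times> nat) set" where
  "diagram \<mu> = {(i, j). i < length (parts \<mu>) \<and> j < parts \<mu> ! i}"


section \<open>Limiting vacillating tableaux\<close>

text \<open>
  The sequence is stored as a list with doubled indices: entry \<open>2 * j\<close> is the partition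
  \<open>\<mu>\<^sup>(\<^sup>j\<^sup>)\<close> and entry \<open>2 * j + 1\<close> is the partition indexed by \<open>j + 1/2\<close>.
\<close>

definition limiting_vacillating_tableau ::
    "nat \<Rightarrow> integer_partition \<Rightarrow> integer_partition list \<Rightarrow> bool" where
  "limiting_vacillating_tableau k \<mu> \<nu> \<longleftrightarrow>
     length \<nu> = 2 * k + 1 \<and> \<nu> ! 0 = empty_partition \<and> \<nu> ! (2 * k) = \<mu> \<and>
     (\<forall>j<k.
        diagram (\<nu> ! (2 * j + 1)) \<subseteq> diagram (\<nu> ! (2 * j)) \<and>
        card (diagram (\<nu> ! (2 * j)) - diagram (\<nu> ! (2 * j + 1))) \<in> {0, 1} \<and>
        diagram (\<nu> ! (2 * j + 1)) \<subseteq> diagram (\<nu> ! (2 * j + 2)) \<and>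
        card (diagram (\<nu> ! (2 * j + 2)) - diagram (\<nu> ! (2 * j + 1))) = 1)"

definition num_lvt :: "nat \<Rightarrow> integer_partition \<Rightarrow> nat" where
  "num_lvt k \<mu> = card {\<nu>. limiting_vacillating_tableau k \<mu> \<nu>}"


section \<open>Formal power series in countably many variables\<close>

text \<open>
  The variables are indexed by \<^typ>\<open>nat\<close> starting from 0. A monomial is its finitely supported
  exponent vector, and a series is an arbitrary coefficient function on monomials.
\<close>

typedef 'a series = "UNIV :: ((nat \<Rightarrow>\<^sub>0 nat) \<Rightarrow> 'a) set"
  morphisms coeff_series Abs_series ..

setup_lifting type_definition_series

lemma series_eqI: "(\<And>m. coeff_series f m = coeff_series g m) \<Longrightarrow> f = g"
  by transfer auto

lemma finite_add_eq: "finite {(a, b). a + b = (m :: nat \<Rightarrow>\<^sub>0 nat)}"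
proof -
  let ?D = "Poly_Mapping.keys m \<rightarrow>\<^sub>E {..Max (insert 0 (Poly_Mapping.lookup m ` Poly_Mapping.keys m))}"
  let ?r = "\<lambda>a :: nat \<Rightarrow>\<^sub>0 nat. restrict (Poly_Mapping.lookup a) (Poly_Mapping.keys m)"
  have le: "Poly_Mapping.lookup a i \<le> Poly_Mapping.lookup m i" if "\<exists>b. a + b = m" for a i
    using that by (auto simp: lookup_add)
  have "?r ` {a. \<exists>b. a + b = m} \<subseteq> ?D"
  proof
    fix g assume "g \<in> ?r ` {a. \<exists>b. a + b = m}"
    then obtain a where a: "\<exists>b. a + b = m" and g: "g = ?r a" by auto
    have "Poly_Mapping.lookup a i \<le> Max (insert 0 (Poly_Mapping.lookup m ` Poly_Mapping.keys m))" if "i \<in> Poly_Mapping.keys m" for i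
    proof -
      have "Poly_Mapping.lookup m i \<le> Max (insert 0 (Poly_Mapping.lookup m ` Poly_Mapping.keys m))"
        using that by (intro Max_ge) auto
      then show ?thesis using le[OF a, of i] by linarith
    qed
    then show "g \<in> ?D" using g by (auto simp: PiE_iff)
  qed
  moreover have "finite ?D" by (intro finite_PiE) auto
  ultimately have "finite (?r ` {a. \<exists>b. a + b = m})" by (rule finite_subset)
  moreover have "inj_on ?r {a. \<exists>b. a + b = m}"
  proof (rule inj_onI)
    fix a a' assume A: "a \<in> {a. \<exists>b. a + b = m}" "a' \<in> {a. \<exists>b. a + b = m}" and e: "?r a = ?r a'"
    show "a = a'"
    proof (rule poly_mapping_eqI)
      fix i
      show "Poly_Mapping.lookup a i = Poly_Mapping.lookup a' i"
      proof (cases "i \<in> Poly_Mapping.keys m")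
        case True
        then show ?thesis using fun_cong[OF e, of i] by simp
      next
        case False
        then have "Poly_Mapping.lookup m i = 0" by (simp add: in_keys_iff)
        then show ?thesis using le[of a i] le[of a' i] A by simp
      qed
    qed
  qed
  ultimately have "finite {a. \<exists>b. a + b = m}" by (rule finite_imageD)
  moreover have "{(a, b). a + b = m} \<subseteq> (\<lambda>a. (a, m - a)) ` {a. \<exists>b. a + b = m}" by auto
  ultimately show ?thesis by (meson finite_imageI finite_subset)
qed

instantiation series :: (comm_ring_1) comm_ring_1
begin

lift_definition zero_series :: "'a series" is "\<lambda>_. 0" .
lift_definition one_series :: "'a series" is "\<lambda>m. if m = 0 then 1 else 0" .
lift_definition plus_series :: "'a series \<Rightarrow> 'a series \<Rightarrow> 'a series" is "\<lambda>f g m. f m + g m" .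
lift_definition uminus_series :: "'a series \<Rightarrow> 'a series" is "\<lambda>f m. - f m" .
lift_definition minus_series :: "'a series \<Rightarrow> 'a series \<Rightarrow> 'a series" is "\<lambda>f g m. f m - g m" .
lift_definition times_series :: "'a series \<Rightarrow> 'a series \<Rightarrow> 'a series" is
  "\<lambda>f g m. \<Sum>(a, b) | a + b = m. f a * g b" .

instance
proof
  fix f g h :: "'a series"
  show "f + g + h = f + (g + h)" by transfer (simp add: add.assoc)
  show "f + g = g + f" by transfer (simp add: add.commute)
  show "0 + f = f" by transfer simp
  show "- f + f = 0" by transfer simp
  show "f - g = f + - g" by transfer simp
  show "(0 :: 'a series) \<noteq> 1"
  proof
    assume "(0 :: 'a series) = 1"
    then have "coeff_series (0 :: 'a series) 0 = coeff_series (1 :: 'a series) 0" by simp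
    then show False by (simp add: zero_series.rep_eq one_series.rep_eq)
  qed
  show "(f + g) * h = f * h + g * h"
    by (rule series_eqI)
      (simp add: times_series.rep_eq plus_series.rep_eq case_prod_unfold distrib_right sum.distrib)
  show "f * g = g * f"
  proof (rule series_eqI)
    fix m
    show "coeff_series (f * g) m = coeff_series (g * f) m"
      unfolding times_series.rep_eq
      by (rule sum.reindex_bij_witness[of _ prod.swap prod.swap])
        (auto simp: add.commute mult.commute)
  qed
  show "1 * f = f"
  proof (rule series_eqI)
    fix m :: "nat \<Rightarrow>\<^sub>0 nat"
    have "coeff_series (1 * f) m = (\<Sum>(a, b) \<in> {(0, m)}. coeff_series 1 a * coeff_series f b)"
      unfolding times_series.rep_eq
      by (intro sum.mono_neutral_right finite_add_eq) (auto simp: one_series.rep_eq split: if_splits)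
    then show "coeff_series (1 * f) m = coeff_series f m" by (simp add: one_series.rep_eq)
  qed
  show "f * g * h = f * (g * h)"
  proof (rule series_eqI)
    fix m :: "nat \<Rightarrow>\<^sub>0 nat"
    let ?f = "coeff_series f" and ?g = "coeff_series g" and ?h = "coeff_series h"
    let ?P = "\<lambda>m. {(a, b). a + b = (m :: nat \<Rightarrow>\<^sub>0 nat)}"
    have "coeff_series (f * g * h) m
        = (\<Sum>p\<in>?P m. \<Sum>q\<in>?P (fst p). ?f (fst q) * ?g (snd q) * ?h (snd p))"
      by (simp add: times_series.rep_eq case_prod_unfold sum_distrib_right)
    also have "\<dots> = (\<Sum>(p, q)\<in>Sigma (?P m) (\<lambda>p. ?P (fst p)). ?f (fst q) * ?g (snd q) * ?h (snd p))"
      by (intro sum.Sigma finite_add_eq ballI)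
    also have "\<dots> = (\<Sum>(p, q)\<in>Sigma (?P m) (\<lambda>p. ?P (snd p)). ?f (fst p) * (?g (fst q) * ?h (snd q)))"
      by (rule sum.reindex_bij_witness[of _
            "\<lambda>(p, q). ((fst p + fst q, snd q), (fst p, fst q))"
            "\<lambda>(p, q). ((fst q, snd q + snd p), (snd q, snd p))"])
        (auto simp: ac_simps)
    also have "\<dots> = (\<Sum>p\<in>?P m. \<Sum>q\<in>?P (snd p). ?f (fst p) * (?g (fst q) * ?h (snd q)))"
      by (intro sum.Sigma[symmetric] finite_add_eq ballI)
    also have "\<dots> = coeff_series (f * (g * h)) m"
      by (simp add: times_series.rep_eq case_prod_unfold sum_distrib_left)
    finally show "coeff_series (f * g * h) m = coeff_series (f * (g * h)) m" .
  qed
qed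

end

lift_definition var_series :: "nat \<Rightarrow> 'a :: comm_ring_1 series" is
  "\<lambda>i m. if m = Poly_Mapping.single i 1 then 1 else 0" .

text \<open>
  The infinite sum of all variables, formed coefficientwise: each monomial occurs in at most one
  variable.
\<close>

lift_definition h1 :: "'a :: comm_ring_1 series" is
  "\<lambda>m. Sum_any (\<lambda>i. coeff_series (var_series i) m)" .


section \<open>Schur functions\<close>

text \<open>Fillings are \<^const>\<open>undefined\<close> outside the diagram, so that distinct functions are distinct tableaux.\<close>

definition semistandard_tableaux :: "integer_partition \<Rightarrow> (nat \<times> nat \<Rightarrow> nat) set" where
  "semistandard_tableaux \<mu> =
     {T \<in> diagram \<mu> \<rightarrow>\<^sub>E UNIV.
        (\<forall>i j j'. (i, j) \<in> diagram \<mu> \<and> (i, j') \<in> diagram \<mu> \<and> j < j' \<longrightarrow> T (i, j) \<le> T (i, j')) \<and>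
        (\<forall>i i' j. (i, j) \<in> diagram \<mu> \<and> (i', j) \<in> diagram \<mu> \<and> i < i' \<longrightarrow> T (i, j) < T (i', j))}"

text \<open>
  The coefficient of a monomial \<open>m\<close> is the number of semistandard tableaux in which every value
  \<open>v\<close> occurs exactly as often as the exponent of the variable \<open>v\<close> in \<open>m\<close>.
\<close>

lift_definition schur :: "integer_partition \<Rightarrow> 'a :: comm_ring_1 series" is
  "\<lambda>\<mu> m. of_nat (card {T \<in> semistandard_tableaux \<mu>.
                        \<forall>v. card {c \<in> diagram \<mu>. T c = v} = Poly_Mapping.lookup m v})" .


section \<open>Finiteness of the counted sets and of the supports of the sums\<close>

lemma diagram_Sigma: "diagram \<mu> = Sigma {..<length (parts \<mu>)} (\<lambda>i. {..<parts \<mu> ! i})"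
  by (auto simp: diagram_def)

lemma finite_diagram [simp]: "finite (diagram \<mu>)"
  by (simp add: diagram_Sigma)

lemma card_diagram: "card (diagram \<mu>) = sum_list (parts \<mu>)"
  by (simp add: diagram_Sigma sum_list_sum_nth atLeast0LessThan)

lemma finite_partitions_le: "finite {\<mu>. card (diagram \<mu>) \<le> n}"
proof -
  have "parts ` {\<mu>. card (diagram \<mu>) \<le> n} \<subseteq> {xs. set xs \<subseteq> {..n} \<and> length xs \<le> n}"
  proof safe
    fix \<mu> x assume le: "card (diagram \<mu>) \<le> n"
    show "x \<le> n" if "x \<in> set (parts \<mu>)"
      using member_le_sum_list[OF that] le by (simp add: card_diagram)
    have "0 \<notin> set (parts \<mu>)" using parts[of \<mu>] by simp
    moreover have "0 \<notin> set xs \<Longrightarrow> length xs \<le> sum_list xs" for xs :: "nat list"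
      by (induction xs) (auto simp: Suc_le_eq)
    ultimately have "length (parts \<mu>) \<le> sum_list (parts \<mu>)" by blast
    then show "length (parts \<mu>) \<le> n" using le by (simp add: card_diagram)
  qed
  then have "finite (parts ` {\<mu>. card (diagram \<mu>) \<le> n})"
    by (rule finite_subset) (simp add: finite_lists_length_le)
  then show ?thesis
    by (rule finite_imageD) (simp add: inj_on_def parts_inject)
qed

lemma lvt_size:
  assumes "limiting_vacillating_tableau k \<mu> \<nu>"
  shows "j \<le> k \<Longrightarrow> card (diagram (\<nu> ! (2 * j))) \<le> j"
    and "j < k \<Longrightarrow> card (diagram (\<nu> ! (2 * j + 1))) \<le> j"
proof -
  have sub: "diagram (\<nu> ! (2 * j + 1)) \<subseteq> diagram (\<nu> ! (2 * j))"
      "diagram (\<nu> ! (2 * j + 1)) \<subseteq> diagram (\<nu> ! (2 * j + 2))"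
      "card (diagram (\<nu> ! (2 * j + 2)) - diagram (\<nu> ! (2 * j + 1))) = 1" if "j < k" for j
    using assms that by (auto simp: limiting_vacillating_tableau_def)
  show *: "j \<le> k \<Longrightarrow> card (diagram (\<nu> ! (2 * j))) \<le> j" for j
  proof (induction j)
    case 0
    then show ?case
      using assms by (simp add: limiting_vacillating_tableau_def diagram_def empty_partition.rep_eq)
  next
    case (Suc j)
    have "card (diagram (\<nu> ! (2 * j + 1))) \<le> j"
      using Suc sub(1)[of j] card_mono[OF finite_diagram, of "diagram (\<nu> ! (2 * j + 1))"]
      by (meson Suc_le_lessD less_imp_le order_trans)
    moreover have "card (diagram (\<nu> ! (2 * j + 2))) = card (diagram (\<nu> ! (2 * j + 1))) + 1"
      using sub(2,3)[of j] Suc.prems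
      by (metis Suc_le_lessD card_Diff_subset card_mono finite_diagram le_add_diff_inverse)
    ultimately show ?case by simp
  qed
  show "j < k \<Longrightarrow> card (diagram (\<nu> ! (2 * j + 1))) \<le> j"
    using *[of j] sub(1)[of j] card_mono[OF finite_diagram]
    by (meson less_imp_le order_trans)
qed

lemma finite_lvt: "finite {\<nu>. limiting_vacillating_tableau k \<mu> \<nu>}"
proof (rule finite_subset)
  show "finite {\<nu>. set \<nu> \<subseteq> {\<mu>. card (diagram \<mu>) \<le> k} \<and> length \<nu> = 2 * k + 1}"
    by (intro finite_lists_length_eq finite_partitions_le)
  have "card (diagram (\<nu> ! i)) \<le> k"
    if lvt: "limiting_vacillating_tableau k \<mu> \<nu>" and "i < 2 * k + 1" for \<nu> i
  proof (cases "even i")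
    case True
    then obtain j where "i = 2 * j" by blast
    then show ?thesis using lvt_size(1)[OF lvt, of j] that by simp
  next
    case False
    then obtain j where "i = 2 * j + 1" using oddE by blast
    then show ?thesis using lvt_size(2)[OF lvt, of j] that by simp
  qed
  then show "{\<nu>. limiting_vacillating_tableau k \<mu> \<nu>}
      \<subseteq> {\<nu>. set \<nu> \<subseteq> {\<mu>. card (diagram \<mu>) \<le> k} \<and> length \<nu> = 2 * k + 1}"
    by (auto simp: in_set_conv_nth limiting_vacillating_tableau_def)
qed

lemma finite_num_lvt_support: "finite {\<mu>. num_lvt k \<mu> \<noteq> 0}"
proof (rule finite_subset[OF _ finite_partitions_le])
  show "{\<mu>. num_lvt k \<mu> \<noteq> 0} \<subseteq> {\<mu>. card (diagram \<mu>) \<le> k}"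
  proof safe
    fix \<mu> assume "num_lvt k \<mu> > 0"
    then obtain \<nu> where lvt: "limiting_vacillating_tableau k \<mu> \<nu>"
      unfolding num_lvt_def by (auto simp: card_gt_0_iff)
    then show "card (diagram \<mu>) \<le> k"
      using lvt_size(1)[OF lvt, of k] by (simp add: limiting_vacillating_tableau_def)
  qed
qed

lemma finite_lhs_support:
  "finite {\<mu>. of_nat (num_lvt k \<mu>) * (schur \<mu> :: 'a :: comm_ring_1 series) \<noteq> 0}"
  by (rule finite_subset[OF _ finite_num_lvt_support[of k]])
    (auto intro: ccontr)

lemma finite_rhs_support:
  "finite {j. of_nat (Stirling k j) * (h1 :: 'a :: comm_ring_1 series) ^ j \<noteq> 0}"
proof (rule finite_subset)
  show "{j. of_nat (Stirling k j) * (h1 :: 'a series) ^ j \<noteq> 0} \<subseteq> {..k}"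
    by (auto intro: ccontr simp: not_le)
qed simp

lemma finite_semistandard_tableaux_weight:
  "finite {T \<in> semistandard_tableaux \<mu>. \<forall>v. card {c \<in> diagram \<mu>. T c = v} = Poly_Mapping.lookup m v}"
proof (rule finite_subset)
  show "finite (diagram \<mu> \<rightarrow>\<^sub>E Poly_Mapping.keys m)" by (intro finite_PiE) auto
  show "{T \<in> semistandard_tableaux \<mu>. \<forall>v. card {c \<in> diagram \<mu>. T c = v} = Poly_Mapping.lookup m v}
      \<subseteq> diagram \<mu> \<rightarrow>\<^sub>E Poly_Mapping.keys m"
  proof
    fix T assume "T \<in> {T \<in> semistandard_tableaux \<mu>. \<forall>v. card {c \<in> diagram \<mu>. T c = v} = Poly_Mapping.lookup m v}"
    then have T: "T \<in> diagram \<mu> \<rightarrow>\<^sub>E UNIV" and w: "\<And>v. card {c \<in> diagram \<mu>. T c = v} = Poly_Mapping.lookup m v"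
      by (auto simp: semistandard_tableaux_def)
    have "T c \<in> Poly_Mapping.keys m" if "c \<in> diagram \<mu>" for c
    proof -
      have "card {c' \<in> diagram \<mu>. T c' = T c} \<noteq> 0"
        using that by (cases c) auto
      then show ?thesis using w[of "T c"] by (simp add: in_keys_iff)
    qed
    then show "T \<in> diagram \<mu> \<rightarrow>\<^sub>E Poly_Mapping.keys m" using T by (auto simp: PiE_iff)
  qed
qed

lemma coeff_h1:
  "coeff_series (h1 :: 'a :: comm_ring_1 series) m =
     (if \<exists>i. m = Poly_Mapping.single i 1 then 1 else 0)"
proof (cases "\<exists>i. m = Poly_Mapping.single i (1 :: nat)")
  case True
  then obtain i where i: "m = Poly_Mapping.single i 1" by blast
  have "(m = Poly_Mapping.single j 1) = (i = j)" for j
    unfolding i by (metis lookup_single_eq lookup_single_not_eq zero_neq_one)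
  then show ?thesis using True by (simp add: h1.rep_eq var_series.rep_eq)
next
  case False
  then show ?thesis by (simp add: h1.rep_eq var_series.rep_eq)
qed

lemma schur_empty: "schur empty_partition = 1"
proof (rule series_eqI)
  fix m
  have d: "diagram empty_partition = {}" by (simp add: diagram_def empty_partition.rep_eq)
  have "{T \<in> semistandard_tableaux empty_partition.
      \<forall>v. card {c \<in> diagram empty_partition. T c = v} = Poly_Mapping.lookup m v}
      = (if m = 0 then {\<lambda>_. undefined} else {})"
    by (auto simp: d semistandard_tableaux_def poly_mapping_eq_iff fun_eq_iff)
  then show "coeff_series (schur empty_partition) m = coeff_series 1 m"
    by (simp add: schur.rep_eq one_series.rep_eq)
qed

end

theory Submission
  imports Defs
begin

text \<open>
  Write \<open>f\<^sup>\<mu>\<close> for the number of standard tableaux of shape \<open>\<mu>\<close>. The theorem follows from two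
  facts: the number of limiting vacillating tableaux of shape \<open>\<mu>\<close> and length \<open>2k\<close> is
  \<open>S(k, |\<mu>|) f\<^sup>\<mu>\<close> (\<open>num_lvt_eq\<close>), and the sum of \<open>f\<^sup>\<mu> s\<^sub>\<mu>\<close> over the partitions of \<open>n\<close> is
  \<open>h\<^sub>1\<^sup>n\<close> (\<open>sum_num_syt_schur\<close>). Grouping the left-hand side by the size of \<open>\<mu>\<close> then gives the
  right-hand side.

  Both facts rest on one count in Young's lattice. For partitions \<open>\<rho>\<close> and \<open>\<nu>\<close>, adding a cell to
  \<open>\<nu>\<close> so that the result is a horizontal strip over \<open>\<rho>\<close> can be done in as many ways as removing a
  cell from \<open>\<rho>\<close> so that \<open>\<nu>\<close> is a horizontal strip over the result, except for one additional way
  if \<open>\<nu>\<close> already is a horizontal strip over \<open>\<rho>\<close> (\<open>card_covers_hstrip_commute\<close>). By induction, the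
  sum of \<open>f\<^sup>\<mu>\<close> over all \<open>\<mu>\<close> that extend \<open>\<rho>\<close> by a horizontal strip of size \<open>r\<close> is
  \<open>binom(|\<rho>| + r, r) f\<^sup>\<rho>\<close> (\<open>sum_num_syt_strips_above\<close>).

  For \<open>r = 1\<close> this says that the \<open>f\<^sup>\<mu>\<close> over the upper covers of \<open>\<rho>\<close> add up to
  \<open>(|\<rho>| + 1) f\<^sup>\<rho>\<close>. A limiting vacillating tableau makes its last two steps by keeping the shape or
  removing a cell, and then adding a cell, so the count for \<open>k + 1\<close> turns into the recurrence
  \<open>S(k + 1, n) = S(k, n - 1) + n S(k, n)\<close>.

  For general \<open>r\<close> it evaluates coefficients. The cells of the largest value in a semistandard
  tableau form a horizontal strip over the shape of the other cells, so removing the values one at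
  a time shows, for the number \<open>K\<^sub>\<mu>\<^sub>,\<^sub>w\<close> of those with content \<open>w\<close>, that the sum of \<open>f\<^sup>\<mu> K\<^sub>\<mu>\<^sub>,\<^sub>w\<close> over the partitions of \<open>n = w\<^sub>0 + w\<^sub>1 + \<dots>\<close> is the
  product of the binomial coefficients \<open>binom(w\<^sub>0 + \<dots> + w\<^sub>v, w\<^sub>v)\<close>, that is, the multinomial
  coefficient of \<open>w\<close>. The same multinomial coefficient is the coefficient of \<open>x\<^sup>w\<close> in \<open>h\<^sub>1\<^sup>n\<close>.
\<close>

section \<open>Partitions through their row lengths\<close>

definition row :: "integer_partition \<Rightarrow> nat \<Rightarrow> nat" where
  "row \<mu> i = (if i < length (parts \<mu>) then parts \<mu> ! i else 0)"

lemma mem_diagram_iff: "(i, j) \<in> diagram \<mu> \<longleftrightarrow> j < row \<mu> i"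
  by (auto simp: diagram_def row_def)

lemma antimono_row: "antimono (row \<mu>)"
proof (rule antimonoI)
  fix i j :: nat assume "i \<le> j"
  moreover have "sorted_wrt (\<ge>) (parts \<mu>)" using parts[of \<mu>] by simp
  ultimately show "row \<mu> j \<le> row \<mu> i"
    by (cases "i = j") (auto simp: row_def sorted_wrt_iff_nth_less)
qed

lemma row_le: "i \<le> j \<Longrightarrow> row \<mu> j \<le> row \<mu> i"
  using antimono_row by (rule antimonoD)

lemma diagram_downward:
  "(i', j') \<in> diagram \<mu> \<Longrightarrow> i \<le> i' \<Longrightarrow> j \<le> j' \<Longrightarrow> (i, j) \<in> diagram \<mu>"
  using row_le[of i i' \<mu>] by (simp add: mem_diagram_iff)

lemma diagram_subset_iff: "diagram \<rho> \<subseteq> diagram \<mu> \<longleftrightarrow> (\<forall>i. row \<rho> i \<le> row \<mu> i)"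
proof
  assume *: "diagram \<rho> \<subseteq> diagram \<mu>"
  show "\<forall>i. row \<rho> i \<le> row \<mu> i"
  proof
    fix i show "row \<rho> i \<le> row \<mu> i"
      using subsetD[OF *, of "(i, row \<mu> i)"] by (auto simp: mem_diagram_iff intro: leI)
  qed
next
  assume "\<forall>i. row \<rho> i \<le> row \<mu> i"
  then have "j < row \<mu> i" if "j < row \<rho> i" for i j using that by (meson less_le_trans)
  then show "diagram \<rho> \<subseteq> diagram \<mu>" by (auto simp: mem_diagram_iff)
qed

lemma row_inject: "row \<rho> = row \<mu> \<longleftrightarrow> \<rho> = \<mu>"
proof
  assume eq: "row \<rho> = row \<mu>"
  have length_iff: "i < length (parts \<nu>) \<longleftrightarrow> row \<nu> i \<noteq> 0" for i \<nu>
  proof -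
    have "0 \<notin> set (parts \<nu>)" using parts[of \<nu>] by simp
    then have "i < length (parts \<nu>) \<Longrightarrow> parts \<nu> ! i \<noteq> 0" by (metis nth_mem)
    then show ?thesis by (simp add: row_def)
  qed
  have "{..<length (parts \<rho>)} = {..<length (parts \<mu>)}"
    by (simp only: lessThan_def length_iff eq)
  then have "length (parts \<rho>) = length (parts \<mu>)" by (metis card_lessThan)
  then have "parts \<rho> = parts \<mu>"
    using eq by (metis (full_types) nth_equalityI row_def)
  then show "\<rho> = \<mu>" by (simp add: parts_inject)
qed simp

lemma diagram_inject: "diagram \<rho> = diagram \<mu> \<longleftrightarrow> \<rho> = \<mu>"
  using diagram_subset_iff[of \<rho> \<mu>] diagram_subset_iff[of \<mu> \<rho>] row_inject[of \<rho> \<mu>]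
  by (metis antisym ext subset_refl)

lemma diagram_empty_partition [simp]: "diagram empty_partition = {}"
  by (simp add: diagram_def empty_partition.rep_eq)

lemma card_diagram_eq_0_iff: "card (diagram \<mu>) = 0 \<longleftrightarrow> \<mu> = empty_partition"
  using diagram_inject[of \<mu> empty_partition] by simp

lemma finite_partitions_card_eq: "finite {\<mu>. card (diagram \<mu>) = n}"
  by (rule finite_subset[OF _ finite_partitions_le[of n]]) auto

lemma partition_with_diagram:
  assumes fin: "finite S"
    and down: "\<And>i j i' j'. (i', j') \<in> S \<Longrightarrow> i \<le> i' \<Longrightarrow> j \<le> j' \<Longrightarrow> (i, j) \<in> S"
  obtains \<mu> where "diagram \<mu> = S"
proof -
  have initial: "{x. P x} = {..<card {x. P x}}"
    if "finite {x. P x}" and "\<And>x y. P y \<Longrightarrow> x \<le> y \<Longrightarrow> P x" for P :: "nat \<Rightarrow> bool"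
  proof (cases "{x. P x} = {}")
    case False
    have "P (Max {x. P x})" using Max_in[OF that(1) False] by simp
    then have "P x \<longleftrightarrow> x \<le> Max {x. P x}" for x
      using that(2) Max_ge[OF that(1), of x] by blast
    then have "{x. P x} = {..Max {x. P x}}" by blast
    then show ?thesis by (metis card_atMost lessThan_Suc_atMost)
  qed (metis card.empty lessThan_0)
  define f where "f i = card {j. (i, j) \<in> S}" for i
  define L where "L = card {i. (i, 0) \<in> S}"
  have "finite {j. (i, j) \<in> S}" for i
    by (rule finite_subset[OF _ finite_imageI[OF fin, of snd]]) force
  then have f: "(i, j) \<in> S \<longleftrightarrow> j < f i" for i j
    using initial[of "\<lambda>j. (i, j) \<in> S"] down[of i _ i] unfolding f_def by blast
  have "finite {i. (i, 0) \<in> S}"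
    by (rule finite_subset[OF _ finite_imageI[OF fin, of fst]]) force
  then have L: "(i, 0) \<in> S \<longleftrightarrow> i < L" for i
    using initial[of "\<lambda>i. (i, 0) \<in> S"] down[of _ 0 _ 0] unfolding L_def by blast
  have pos: "0 < f i \<longleftrightarrow> i < L" for i using f L by blast
  have anti: "f i' \<le> f i" if "i \<le> i'" for i i'
    using f down[of i' "f i" i "f i"] that by (meson leI le_refl less_irrefl)
  have nonzero: "i < L \<Longrightarrow> f i \<noteq> 0" for i using pos[of i] by simp
  let ?xs = "map f [0..<L]"
  have "parts (Abs_integer_partition ?xs) = ?xs"
    by (rule Abs_integer_partition_inverse)
      (use nonzero anti in \<open>force simp: sorted_wrt_iff_nth_less\<close>)
  moreover have "(i, j) \<in> S \<longleftrightarrow> i < L \<and> j < f i" for i j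
    using f pos by (metis gr_zeroI less_nat_zero_code)
  ultimately have "diagram (Abs_integer_partition ?xs) = S"
    by (auto simp: diagram_def)
  then show ?thesis by (rule that)
qed

text \<open>
  A weakly decreasing sequence is the sequence of row lengths of a partition as soon as it is
  bounded by the rows of some partition up to finitely many corrections; all sequences below arise
  from a partition by a change in one row.
\<close>

lemma partition_with_rows:
  assumes anti: "antimono f" and le: "\<And>i. f i \<le> row \<mu> i + c i" and fin: "finite {i. c i \<noteq> 0}"
  obtains \<rho> where "row \<rho> = f"
proof -
  let ?S = "Sigma UNIV (\<lambda>i. {..<f i})"
  have "?S \<subseteq> diagram \<mu> \<union> Sigma {i. c i \<noteq> 0} (\<lambda>i. {..<f i})"
  proof
    fix x assume "x \<in> ?S"
    then obtain i j where x: "x = (i, j)" "j < f i" by auto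
    then show "x \<in> diagram \<mu> \<union> Sigma {i. c i \<noteq> 0} (\<lambda>i. {..<f i})"
      using le[of i] by (cases "c i = 0") (auto simp: mem_diagram_iff)
  qed
  moreover have "finite (diagram \<mu> \<union> Sigma {i. c i \<noteq> 0} (\<lambda>i. {..<f i}))"
    using fin by simp
  ultimately have "finite ?S" by (rule finite_subset)
  moreover have "(i, j) \<in> ?S" if "(i', j') \<in> ?S" "i \<le> i'" "j \<le> j'" for i j i' j'
    using that antimonoD[OF anti, of i i'] by simp
  ultimately obtain \<rho> where \<rho>: "diagram \<rho> = ?S" by (rule partition_with_diagram)
  have "j < row \<rho> i \<longleftrightarrow> j < f i" for i j
    using \<rho> mem_diagram_iff[of i j \<rho>] by simp
  then have "row \<rho> i = f i" for i by (metis linorder_neqE_nat less_irrefl)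
  then show ?thesis using that by blast
qed


section \<open>Covers and horizontal strips in Young's lattice\<close>

definition covers :: "integer_partition \<Rightarrow> integer_partition \<Rightarrow> bool" where
  "covers \<rho> \<mu> \<longleftrightarrow> diagram \<rho> \<subseteq> diagram \<mu> \<and> card (diagram \<mu> - diagram \<rho>) = 1"

definition interlaced :: "(nat \<Rightarrow> nat) \<Rightarrow> (nat \<Rightarrow> nat) \<Rightarrow> bool" where
  "interlaced f g \<longleftrightarrow> (\<forall>i. f i \<le> g i \<and> g (Suc i) \<le> f i)"

text \<open>
  \<open>hstrip \<rho> \<mu>\<close> says that \<open>\<mu>/\<rho>\<close> is a horizontal strip, that is, it has at most one cell in each
  column. In terms of rows this is interlacing.
\<close>

definition hstrip :: "integer_partition \<Rightarrow> integer_partition \<Rightarrow> bool" where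
  "hstrip \<rho> \<mu> \<longleftrightarrow> interlaced (row \<rho>) (row \<mu>)"

lemma covers_iff_row: "covers \<rho> \<mu> \<longleftrightarrow> (\<exists>i. row \<mu> = (row \<rho>)(i := Suc (row \<rho> i)))"
proof
  assume "covers \<rho> \<mu>"
  then obtain i j where sub: "diagram \<rho> \<subseteq> diagram \<mu>" and ij: "diagram \<mu> - diagram \<rho> = {(i, j)}"
    unfolding covers_def by (metis card_1_singletonE surj_pair)
  have *: "row \<rho> i' \<le> j' \<and> j' < row \<mu> i' \<longleftrightarrow> i' = i \<and> j' = j" for i' j'
    using ij mem_diagram_iff[of i' j'] by (metis DiffI DiffE not_le prod.inject singletonD singletonI)
  have le: "row \<rho> i' \<le> row \<mu> i'" for i' using sub by (simp add: diagram_subset_iff)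
  have "row \<mu> i' = row \<rho> i'" if "i' \<noteq> i" for i'
    using *[of i' "row \<rho> i'"] le[of i'] that by auto
  moreover have "row \<mu> i = Suc (row \<rho> i)"
  proof -
    have "row \<rho> i < row \<mu> i" using *[of i j] by auto
    then have "row \<rho> i = j" "row \<mu> i - 1 = j"
      using *[of i "row \<rho> i"] *[of i "row \<mu> i - 1"] by auto
    then show ?thesis using \<open>row \<rho> i < row \<mu> i\<close> by simp
  qed
  ultimately show "\<exists>i. row \<mu> = (row \<rho>)(i := Suc (row \<rho> i))" by (intro exI[of _ i]) auto
next
  assume "\<exists>i. row \<mu> = (row \<rho>)(i := Suc (row \<rho> i))"
  then obtain i where i: "row \<mu> = (row \<rho>)(i := Suc (row \<rho> i))" by blast
  have "diagram \<mu> - diagram \<rho> = {(i, row \<rho> i)}"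
    by (auto simp: mem_diagram_iff i split: if_splits)
  then show "covers \<rho> \<mu>" by (simp add: covers_def diagram_subset_iff i)
qed

lemma card_diagram_covers: "covers \<rho> \<mu> \<Longrightarrow> card (diagram \<mu>) = Suc (card (diagram \<rho>))"
  unfolding covers_def
  by (metis Suc_eq_plus1 add.commute card_Diff_subset card_mono finite_diagram le_add_diff_inverse2)

lemma not_covers_empty: "\<not> covers \<rho> empty_partition"
  using card_diagram_covers[of \<rho> empty_partition] by auto

lemma hstrip_iff_diagram:
  "hstrip \<rho> \<mu> \<longleftrightarrow>
     diagram \<rho> \<subseteq> diagram \<mu> \<and> (\<forall>i j. (Suc i, j) \<in> diagram \<mu> \<longrightarrow> (i, j) \<in> diagram \<rho>)"
  unfolding hstrip_def interlaced_def diagram_subset_iff mem_diagram_iff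
  by (meson leI less_le_trans less_irrefl)

lemma covers_iff_hstrip:
  "covers \<rho> \<mu> \<longleftrightarrow> hstrip \<rho> \<mu> \<and> card (diagram \<mu>) = card (diagram \<rho>) + 1"
proof
  assume c: "covers \<rho> \<mu>"
  then obtain i where i: "row \<mu> = (row \<rho>)(i := Suc (row \<rho> i))" by (auto simp: covers_iff_row)
  have "row \<mu> (Suc k) \<le> row \<rho> k" for k
  proof (cases "Suc k = i")
    case True
    \<comment> \<open>The new cell sits in the lower of the two rows, and the upper row is unchanged.\<close>
    then have "row \<mu> k = row \<rho> k" by (auto simp: i)
    then show ?thesis using row_le[of k "Suc k" \<mu>] by simp
  next
    case False
    then show ?thesis using row_le[of k "Suc k" \<rho>] by (simp add: i)
  qed
  then show "hstrip \<rho> \<mu> \<and> card (diagram \<mu>) = card (diagram \<rho>) + 1"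
    using card_diagram_covers[OF c] by (auto simp: hstrip_def interlaced_def i)
next
  assume "hstrip \<rho> \<mu> \<and> card (diagram \<mu>) = card (diagram \<rho>) + 1"
  then show "covers \<rho> \<mu>"
    by (auto simp: hstrip_iff_diagram covers_def card_Diff_subset)
qed

text \<open>
  Each sequence separates consecutive entries of the other. Hence a changed row sequence that
  interlaces with the rows of a partition belongs to a partition itself, and the changes can be
  counted as changes of sequences.
\<close>

lemma interlaced_antimono:
  assumes "interlaced f g" shows "antimono f" "antimono g"
proof -
  have *: "f i \<le> g i" "g (Suc i) \<le> f i" for i using assms by (auto simp: interlaced_def)
  have "f (Suc i) \<le> f i" "g (Suc i) \<le> g i" for i
    using order_trans[OF *(1)[of "Suc i"] *(2)[of i]] order_trans[OF *(2)[of i] *(1)[of i]] by auto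
  then show "antimono f" "antimono g" by (simp_all add: antimono_iff_le_Suc)
qed

text \<open>
  Interlacing means that the sequence \<open>n 0, l 0, n 1, l 1, \<dots>\<close> is weakly decreasing. If it is, then
  \<open>n (Suc i)\<close> can be increased if and only if \<open>l i\<close> can be decreased, namely if
  \<open>n (Suc i) < l i\<close>; only \<open>n 0\<close>, which can always be increased, has no partner. If it is not, then
  increasing \<open>n i\<close> and decreasing \<open>l i\<close> repair the same violation \<open>l i = Suc (n i)\<close>, and one of
  them produces an interlaced pair if and only if the other does, since \<open>l\<close> and \<open>n\<close> are decreasing.
\<close>

lemma card_interlaced_commute:
  fixes l n :: "nat \<Rightarrow> nat"
  assumes l: "antimono l" and n: "antimono n" and fin: "finite {i. l i \<noteq> 0}"
  shows "card {i. interlaced l (n(i := Suc (n i)))} =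
         card {i. 0 < l i \<and> interlaced (l(i := l i - 1)) n} + (if interlaced l n then 1 else 0)"
    (is "card ?A = card ?B + _")
proof (cases "interlaced l n")
  case True
  then have le: "l i \<le> n i" "n (Suc i) \<le> l i" for i by (auto simp: interlaced_def)
  have A: "i \<in> ?A \<longleftrightarrow> (\<forall>k. i = Suc k \<longrightarrow> n i < l k)" for i
    using le by (auto simp: interlaced_def le_SucI)
  have B: "i \<in> ?B \<longleftrightarrow> n (Suc i) < l i" for i
    using le by (auto simp: interlaced_def diff_le_mono le_diff_conv le_SucI)
  have "?A = insert 0 (Suc ` ?B)"
  proof (rule set_eqI)
    fix i show "i \<in> ?A \<longleftrightarrow> i \<in> insert 0 (Suc ` ?B)"
      unfolding A by (cases i) (use B in \<open>auto simp: image_iff\<close>)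
  qed
  moreover have "finite ?B" by (rule finite_subset[OF _ fin]) auto
  ultimately show ?thesis using True by (simp add: card_image)
next
  case False
  have "i \<in> ?A \<longleftrightarrow> i \<in> ?B" for i
  proof
    assume "i \<in> ?A"
    then have *: "l j \<le> (n(i := Suc (n i))) j" "(n(i := Suc (n i))) (Suc j) \<le> l j" for j
      by (auto simp: interlaced_def)
    have up: "l j \<le> n j" if "j \<noteq> i" for j using *(1)[of j] that by simp
    have low: "n (Suc j) \<le> l j" for j using *(2)[of j] by (simp split: if_splits)
    have "l i = Suc (n i)"
      using False up low *(1)[of i] unfolding interlaced_def
      by (metis fun_upd_same le_SucE)
    then show "i \<in> ?B"
      using up low antimonoD[OF n, of i "Suc i"] by (auto simp: interlaced_def)
  next
    assume "i \<in> ?B"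
    then have "0 < l i" and *: "(l(i := l i - 1)) j \<le> n j" "n (Suc j) \<le> (l(i := l i - 1)) j" for j
      by (auto simp: interlaced_def)
    have up: "l j \<le> n j" if "j \<noteq> i" for j using *(1)[of j] that by simp
    have low: "n (Suc j) \<le> l j" for j
      using *(2)[of j] by (simp split: if_splits)
    have "\<not> l i \<le> n i"
      using False up low unfolding interlaced_def by metis
    then have li: "l i = Suc (n i)" using *(1)[of i] by simp
    have "Suc (n i) \<le> l k" if "i = Suc k" for k
      using antimonoD[OF l, of k i] that li by simp
    then show "i \<in> ?A"
      using up low li by (auto simp: interlaced_def)
  qed
  then have "?A = ?B" by blast
  then show ?thesis using False by simp
qed

text \<open>
  This is the relation between the operator that removes a cell and the operators that add a
  horizontal strip. If \<open>\<rho>\<close> and \<open>\<nu>\<close> have the same size, it is the relation \<open>D U = U D + 1\<close> of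
  Young's lattice.
\<close>

lemma card_covers_hstrip_commute:
  "card {\<mu>. covers \<nu> \<mu> \<and> hstrip \<rho> \<mu>} =
   card {\<kappa>. covers \<kappa> \<rho> \<and> hstrip \<kappa> \<nu>} + (if hstrip \<rho> \<nu> then 1 else 0)"
    (is "card ?U = card ?D + _")
proof -
  let ?A = "{i. interlaced (row \<rho>) ((row \<nu>)(i := Suc (row \<nu> i)))}"
  let ?B = "{i. 0 < row \<rho> i \<and> interlaced ((row \<rho>)(i := row \<rho> i - 1)) (row \<nu>)}"
  have inj: "inj_on row X" for X by (simp add: inj_on_def row_inject)
  have "row ` ?U = (\<lambda>i. (row \<nu>)(i := Suc (row \<nu> i))) ` ?A"
  proof (intro subset_antisym subsetI; elim imageE)
    fix f i assume f: "f = (row \<nu>)(i := Suc (row \<nu> i))" and i: "i \<in> ?A"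
    from i have "antimono f" unfolding f by (auto dest: interlaced_antimono)
    then obtain \<mu> where \<mu>: "row \<mu> = f"
      by (rule partition_with_rows[where \<mu> = \<nu> and c = "\<lambda>j. if j = i then 1 else 0"])
        (auto simp: f)
    then have "covers \<nu> \<mu>" "hstrip \<rho> \<mu>" using i by (auto simp: f covers_iff_row hstrip_def)
    then show "f \<in> row ` ?U" using \<mu> by blast
  next
    fix f \<mu> assume "f = row \<mu>" "\<mu> \<in> ?U"
    then show "f \<in> (\<lambda>i. (row \<nu>)(i := Suc (row \<nu> i))) ` ?A"
      by (auto simp: covers_iff_row hstrip_def)
  qed
  moreover have "inj_on (\<lambda>i. (row \<nu>)(i := Suc (row \<nu> i))) ?A"
  proof (rule inj_onI)
    fix i j assume "(row \<nu>)(i := Suc (row \<nu> i)) = (row \<nu>)(j := Suc (row \<nu> j))"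
    from fun_cong[OF this, of i] show "i = j" by (simp split: if_splits)
  qed
  ultimately have U: "card ?U = card ?A"
    using card_image[OF inj, of ?U] by (simp only: card_image)
  have "row ` ?D = (\<lambda>i. (row \<rho>)(i := row \<rho> i - 1)) ` ?B"
  proof (intro subset_antisym subsetI; elim imageE)
    fix f i assume f: "f = (row \<rho>)(i := row \<rho> i - 1)" and i: "i \<in> ?B"
    from i have "antimono f" unfolding f by (auto dest: interlaced_antimono)
    then obtain \<kappa> where \<kappa>: "row \<kappa> = f"
      by (rule partition_with_rows[where \<mu> = \<rho> and c = "\<lambda>_. 0"]) (auto simp: f)
    have "row \<rho> = (row \<kappa>)(i := Suc (row \<kappa> i))" using i by (auto simp: \<kappa> f)
    then have "covers \<kappa> \<rho>" by (auto simp: covers_iff_row)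
    moreover have "hstrip \<kappa> \<nu>" using i by (simp add: hstrip_def \<kappa> f)
    ultimately show "f \<in> row ` ?D" using \<kappa> by blast
  next
    fix f \<kappa> assume f: "f = row \<kappa>" and \<kappa>: "\<kappa> \<in> ?D"
    then obtain i where i: "row \<rho> = (row \<kappa>)(i := Suc (row \<kappa> i))" by (auto simp: covers_iff_row)
    then have "f = (row \<rho>)(i := row \<rho> i - 1)" by (auto simp: f)
    moreover from this have "i \<in> ?B" using \<kappa> f by (auto simp: hstrip_def i)
    ultimately show "f \<in> (\<lambda>i. (row \<rho>)(i := row \<rho> i - 1)) ` ?B" by blast
  qed
  moreover have "inj_on (\<lambda>i. (row \<rho>)(i := row \<rho> i - 1)) ?B"
  proof (rule inj_onI)
    fix i j assume "i \<in> ?B" and "(row \<rho>)(i := row \<rho> i - 1) = (row \<rho>)(j := row \<rho> j - 1)"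
    from fun_cong[OF this(2), of i] this(1) show "i = j" by (simp split: if_splits)
  qed
  ultimately have D: "card ?D = card ?B"
    using card_image[OF inj, of ?D] by (simp only: card_image)
  have "{i. row \<rho> i \<noteq> 0} \<subseteq> {..<length (parts \<rho>)}" by (auto simp: row_def)
  then have "finite {i. row \<rho> i \<noteq> 0}" by (rule finite_subset) simp
  then show ?thesis
    using card_interlaced_commute[OF antimono_row antimono_row, of \<rho> \<nu>]
    unfolding U D hstrip_def[of \<rho> \<nu>] by blast
qed


section \<open>Standard tableaux\<close>

text \<open>
  The cell with the largest entry of a standard tableau is a corner, so standard tableaux are the
  same as saturated chains from the empty partition.
\<close>

function num_syt :: "integer_partition \<Rightarrow> nat" where
  "num_syt \<mu> = (if \<mu> = empty_partition then 1 else \<Sum>\<rho> | covers \<rho> \<mu>. num_syt \<rho>)"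
  by auto
termination
  by (relation "measure (\<lambda>\<mu>. card (diagram \<mu>))") (auto dest: card_diagram_covers)

declare num_syt.simps [simp del]

lemma num_syt_empty [simp]: "num_syt empty_partition = 1"
  by (simp add: num_syt.simps)

lemma num_syt_rec: "\<mu> \<noteq> empty_partition \<Longrightarrow> num_syt \<mu> = (\<Sum>\<rho> | covers \<rho> \<mu>. num_syt \<rho>)"
  by (subst num_syt.simps) simp

lemma finite_covers: "finite {\<rho>. covers \<rho> \<mu>}" "finite {\<mu>. covers \<rho> \<mu>}"
proof -
  show "finite {\<rho>. covers \<rho> \<mu>}"
    by (rule finite_subset[OF _ finite_partitions_le[of "card (diagram \<mu>)"]])
      (auto dest: card_diagram_covers)
  show "finite {\<mu>. covers \<rho> \<mu>}"
    by (rule finite_subset[OF _ finite_partitions_le[of "Suc (card (diagram \<rho>))"]])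
      (auto dest: card_diagram_covers)
qed

definition strips_above :: "integer_partition \<Rightarrow> nat \<Rightarrow> integer_partition set" where
  "strips_above \<rho> r = {\<mu>. hstrip \<rho> \<mu> \<and> card (diagram \<mu>) = card (diagram \<rho>) + r}"

lemma finite_strips_above: "finite (strips_above \<rho> r)"
  by (rule finite_subset[OF _ finite_partitions_card_eq[of "card (diagram \<rho>) + r"]])
    (auto simp: strips_above_def)

lemma strips_above_0: "strips_above \<rho> 0 = {\<rho>}"
proof -
  have "\<mu> = \<rho>" if "hstrip \<rho> \<mu>" "card (diagram \<mu>) = card (diagram \<rho>)" for \<mu>
    using that card_subset_eq[of "diagram \<mu>" "diagram \<rho>"]
    by (auto simp: hstrip_iff_diagram diagram_inject)
  moreover have "hstrip \<rho> \<rho>" by (auto simp: hstrip_def interlaced_def row_le)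
  ultimately show ?thesis by (auto simp: strips_above_def)
qed

text \<open>
  Expand each \<open>num_syt \<mu>\<close> over the lower covers \<open>\<nu>\<close> of \<open>\<mu>\<close> and exchange the order of summation. By
  the commutation count, a given \<open>\<nu>\<close> then occurs once for each lower cover \<open>\<kappa>\<close> of \<open>\<rho>\<close> over which it
  is a strip of size \<open>r\<close>, and once more if it is a strip of size \<open>r - 1\<close> over \<open>\<rho>\<close> itself. The
  induction hypothesis for these smaller cases gives the two terms of Pascal's rule.
\<close>

lemma sum_num_syt_strips_above:
  "(\<Sum>\<mu>\<in>strips_above \<rho> r. num_syt \<mu>) = (card (diagram \<rho>) + r choose r) * num_syt \<rho>"
proof (induction "card (diagram \<rho>) + r" arbitrary: \<rho> r rule: less_induct)
  case less
  show ?case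
  proof (cases r)
    case 0
    then show ?thesis by (simp add: strips_above_0)
  next
    case (Suc s)
    define n where "n = card (diagram \<rho>)"
    let ?N = "{\<nu>. card (diagram \<nu>) = n + s}"
    have fin: "finite ?N" by (rule finite_partitions_card_eq)
    have ne: "\<mu> \<noteq> empty_partition" if "\<mu> \<in> strips_above \<rho> r" for \<mu>
      using that Suc by (auto simp: strips_above_def)
    \<comment> \<open>Pascal's rule. If \<open>\<rho>\<close> is empty, the sum is empty and the other two binomial coefficients are 1.\<close>
    have cover_sum: "(\<Sum>\<kappa> | covers \<kappa> \<rho>. num_syt \<kappa>) * (n + s choose r) + (n + s choose s) * num_syt \<rho>
        = (n + r choose r) * num_syt \<rho>"
    proof (cases "\<rho> = empty_partition")
      case True
      then show ?thesis using Suc by (simp add: n_def not_covers_empty)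
    next
      case False
      then show ?thesis using Suc by (simp add: num_syt_rec[of \<rho>] algebra_simps)
    qed
    have "(\<Sum>\<mu>\<in>strips_above \<rho> r. num_syt \<mu>)
        = (\<Sum>\<mu>\<in>strips_above \<rho> r. \<Sum>\<nu> | \<nu> \<in> ?N \<and> covers \<nu> \<mu>. num_syt \<nu>)"
    proof (rule sum.cong[OF refl])
      fix \<mu> assume \<mu>: "\<mu> \<in> strips_above \<rho> r"
      then have "{\<nu>. \<nu> \<in> ?N \<and> covers \<nu> \<mu>} = {\<nu>. covers \<nu> \<mu>}"
        using Suc by (auto simp: strips_above_def n_def dest: card_diagram_covers)
      then show "num_syt \<mu> = (\<Sum>\<nu> | \<nu> \<in> ?N \<and> covers \<nu> \<mu>. num_syt \<nu>)"
        using num_syt_rec[OF ne[OF \<mu>]] by simp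
    qed
    also have "\<dots> = (\<Sum>\<nu>\<in>?N. \<Sum>\<mu> | \<mu> \<in> strips_above \<rho> r \<and> covers \<nu> \<mu>. num_syt \<nu>)"
      by (rule sum.swap_restrict[OF finite_strips_above fin])
    also have "\<dots> = (\<Sum>\<nu>\<in>?N. (\<Sum>\<kappa> | covers \<kappa> \<rho> \<and> hstrip \<kappa> \<nu>. num_syt \<nu>)
        + (if hstrip \<rho> \<nu> then num_syt \<nu> else 0))"
    proof (rule sum.cong[OF refl])
      fix \<nu> assume "\<nu> \<in> ?N"
      then have "{\<mu>. \<mu> \<in> strips_above \<rho> r \<and> covers \<nu> \<mu>} = {\<mu>. covers \<nu> \<mu> \<and> hstrip \<rho> \<mu>}"
        using Suc by (auto simp: strips_above_def n_def dest: card_diagram_covers)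
      then show "(\<Sum>\<mu> | \<mu> \<in> strips_above \<rho> r \<and> covers \<nu> \<mu>. num_syt \<nu>)
          = (\<Sum>\<kappa> | covers \<kappa> \<rho> \<and> hstrip \<kappa> \<nu>. num_syt \<nu>) + (if hstrip \<rho> \<nu> then num_syt \<nu> else 0)"
        by (simp add: card_covers_hstrip_commute)
    qed
    also have "\<dots> = (\<Sum>\<nu>\<in>?N. \<Sum>\<kappa> | \<kappa> \<in> {\<kappa>. covers \<kappa> \<rho>} \<and> hstrip \<kappa> \<nu>. num_syt \<nu>)
        + (\<Sum>\<nu> | \<nu> \<in> ?N \<and> hstrip \<rho> \<nu>. num_syt \<nu>)"
      by (simp add: sum.distrib sum.inter_filter[OF fin, symmetric])
    also have "(\<Sum>\<nu>\<in>?N. \<Sum>\<kappa> | \<kappa> \<in> {\<kappa>. covers \<kappa> \<rho>} \<and> hstrip \<kappa> \<nu>. num_syt \<nu>)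
        = (\<Sum>\<kappa> | covers \<kappa> \<rho>. \<Sum>\<nu> | \<nu> \<in> ?N \<and> hstrip \<kappa> \<nu>. num_syt \<nu>)"
      by (rule sum.swap_restrict[OF fin finite_covers(1)])
    also have "\<dots> = (\<Sum>\<kappa> | covers \<kappa> \<rho>. (n + s choose r) * num_syt \<kappa>)"
    proof (rule sum.cong[OF refl])
      fix \<kappa> assume "\<kappa> \<in> {\<kappa>. covers \<kappa> \<rho>}"
      then have c: "n = Suc (card (diagram \<kappa>))" using card_diagram_covers by (auto simp: n_def)
      then have "{\<nu>. \<nu> \<in> ?N \<and> hstrip \<kappa> \<nu>} = strips_above \<kappa> r"
        using Suc by (auto simp: strips_above_def)
      moreover have "(\<Sum>\<nu>\<in>strips_above \<kappa> r. num_syt \<nu>) = (card (diagram \<kappa>) + r choose r) * num_syt \<kappa>"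
        by (rule less) (use c in \<open>simp add: n_def\<close>)
      ultimately show "(\<Sum>\<nu> | \<nu> \<in> ?N \<and> hstrip \<kappa> \<nu>. num_syt \<nu>) = (n + s choose r) * num_syt \<kappa>"
        using c Suc by simp
    qed
    also have "{\<nu>. \<nu> \<in> ?N \<and> hstrip \<rho> \<nu>} = strips_above \<rho> s"
      by (auto simp: strips_above_def n_def)
    also have "(\<Sum>\<nu>\<in>strips_above \<rho> s. num_syt \<nu>) = (n + s choose s) * num_syt \<rho>"
      unfolding n_def by (rule less) (use Suc in simp)
    finally show ?thesis
      using cover_sum by (simp add: n_def sum_distrib_left mult.commute)
  qed
qed

lemma sum_num_syt_covers:
  "(\<Sum>\<mu> | covers \<rho> \<mu>. num_syt \<mu>) = Suc (card (diagram \<rho>)) * num_syt \<rho>"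
  using sum_num_syt_strips_above[of \<rho> 1]
  by (simp add: strips_above_def covers_iff_hstrip)


section \<open>Limiting vacillating tableaux\<close>

lemma diagram_remove_le_one_iff:
  "diagram \<rho> \<subseteq> diagram \<kappa> \<and> card (diagram \<kappa> - diagram \<rho>) \<in> {0, 1} \<longleftrightarrow> \<kappa> = \<rho> \<or> covers \<rho> \<kappa>"
  by (auto simp: covers_def diagram_inject[symmetric])

lemma lvt_Suc_iff:
  "limiting_vacillating_tableau (Suc k) \<mu> xs \<longleftrightarrow>
     (\<exists>ys \<rho> \<kappa>. xs = ys @ [\<rho>, \<mu>] \<and> limiting_vacillating_tableau k \<kappa> ys \<and>
        (\<kappa> = \<rho> \<or> covers \<rho> \<kappa>) \<and> covers \<rho> \<mu>)"
    (is "?L \<longleftrightarrow> ?R")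
proof
  assume L: ?L
  let ?ys = "take (2 * k + 1) xs"
  have len: "length xs = 2 * k + 3" and last: "xs ! (2 * k + 2) = \<mu>"
    using L by (simp_all add: limiting_vacillating_tableau_def)
  have "xs = ?ys @ [xs ! (2 * k + 1), xs ! (2 * k + 2)]"
  proof (rule nth_equalityI)
    fix i assume "i < length xs"
    then consider "i < 2 * k + 1" | "i = 2 * k + 1" | "i = 2 * k + 2" using len by linarith
    then show "xs ! i = (?ys @ [xs ! (2 * k + 1), xs ! (2 * k + 2)]) ! i"
      using len by cases (simp_all add: nth_append)
  qed (simp add: len)
  moreover have "limiting_vacillating_tableau k (xs ! (2 * k)) ?ys"
    using L len by (simp add: limiting_vacillating_tableau_def)
  moreover have "xs ! (2 * k) = xs ! (2 * k + 1) \<or> covers (xs ! (2 * k + 1)) (xs ! (2 * k))"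
    using L unfolding diagram_remove_le_one_iff[symmetric]
    by (simp add: limiting_vacillating_tableau_def All_less_Suc)
  moreover have "covers (xs ! (2 * k + 1)) \<mu>"
    using L unfolding last[symmetric]
    by (simp add: limiting_vacillating_tableau_def covers_def All_less_Suc)
  ultimately show ?R using last by metis
next
  assume ?R
  then obtain ys \<rho> \<kappa> where xs: "xs = ys @ [\<rho>, \<mu>]" and ys: "limiting_vacillating_tableau k \<kappa> ys"
    and steps: "\<kappa> = \<rho> \<or> covers \<rho> \<kappa>" "covers \<rho> \<mu>" by blast
  from ys have len: "length ys = 2 * k + 1" and last: "ys ! (2 * k) = \<kappa>"
    by (simp_all add: limiting_vacillating_tableau_def)
  have "xs ! (2 * k) = \<kappa>" "xs ! (2 * k + 1) = \<rho>" "xs ! (2 * k + 2) = \<mu>"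
    using len last by (simp_all add: xs nth_append)
  moreover have "xs ! i = ys ! i" if "i \<le> 2 * k" for i
    using that len by (simp add: xs nth_append)
  ultimately show ?L
    using ys steps diagram_remove_le_one_iff[of \<rho> \<kappa>]
    by (simp add: limiting_vacillating_tableau_def All_less_Suc xs covers_def)
qed

lemma num_lvt_Suc:
  "num_lvt (Suc k) \<mu> = (\<Sum>\<rho> | covers \<rho> \<mu>. num_lvt k \<rho> + (\<Sum>\<kappa> | covers \<rho> \<kappa>. num_lvt k \<kappa>))"
proof -
  let ?L = "\<lambda>\<mu>. {xs. limiting_vacillating_tableau k \<mu> xs}"
  let ?ext = "\<lambda>\<rho>. (\<Union>\<kappa>\<in>insert \<rho> {\<kappa>. covers \<rho> \<kappa>}. (\<lambda>ys. ys @ [\<rho>, \<mu>]) ` ?L \<kappa>)"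
  have shape: "\<kappa> = \<kappa>'" if "xs \<in> ?L \<kappa>" "xs \<in> ?L \<kappa>'" for xs \<kappa> \<kappa>'
    using that by (simp add: limiting_vacillating_tableau_def)
  have card_ext: "card (?ext \<rho>) = num_lvt k \<rho> + (\<Sum>\<kappa> | covers \<rho> \<kappa>. num_lvt k \<kappa>)" for \<rho>
  proof -
    have "card (?ext \<rho>)
        = (\<Sum>\<kappa>\<in>insert \<rho> {\<kappa>. covers \<rho> \<kappa>}. card ((\<lambda>ys. ys @ [\<rho>, \<mu>]) ` ?L \<kappa>))"
      by (rule card_UN_disjoint) (use shape in \<open>auto simp: finite_covers finite_lvt\<close>)
    also have "\<dots> = (\<Sum>\<kappa>\<in>insert \<rho> {\<kappa>. covers \<rho> \<kappa>}. num_lvt k \<kappa>)"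
      by (simp add: card_image inj_on_def num_lvt_def)
    also have "\<rho> \<notin> {\<kappa>. covers \<rho> \<kappa>}" by (simp add: covers_def)
    ultimately show ?thesis by (simp add: finite_covers)
  qed
  have "num_lvt (Suc k) \<mu> = card (\<Union>\<rho>\<in>{\<rho>. covers \<rho> \<mu>}. ?ext \<rho>)"
    unfolding num_lvt_def lvt_Suc_iff by (rule arg_cong[of _ _ card]) blast
  also have "\<dots> = (\<Sum>\<rho> | covers \<rho> \<mu>. card (?ext \<rho>))"
    by (rule card_UN_disjoint) (auto simp: finite_covers finite_lvt)
  finally show ?thesis by (simp only: card_ext)
qed

text \<open>
  Consider the shape between the last removal and the last addition. If \<open>|\<mu>| = n + 1\<close>, it has
  size \<open>n\<close>. The tableaux in which no cell was removed contribute the factor \<open>S(k, n)\<close>, and those in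
  which a cell was removed contribute \<open>(n + 1) S(k, n + 1)\<close>, where \<open>n + 1\<close> comes from
  \<open>sum_num_syt_covers\<close>.
\<close>

lemma num_lvt_eq: "num_lvt k \<mu> = Stirling k (card (diagram \<mu>)) * num_syt \<mu>"
proof (induction k arbitrary: \<mu>)
  case 0
  have "{xs. limiting_vacillating_tableau 0 \<mu> xs} = (if \<mu> = empty_partition then {[\<mu>]} else {})"
    by (auto simp: limiting_vacillating_tableau_def length_Suc_conv)
  then show ?case
    using card_diagram_eq_0_iff[of \<mu>] by (cases "card (diagram \<mu>)") (simp_all add: num_lvt_def)
next
  case (Suc k)
  show ?case
  proof (cases "\<mu> = empty_partition")
    case True
    then show ?thesis by (simp add: num_lvt_Suc not_covers_empty)
  next
    case False
    then obtain n where n: "card (diagram \<mu>) = Suc n"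
      using card_diagram_eq_0_iff[of \<mu>] not0_implies_Suc by blast
    have "num_lvt k \<rho> + (\<Sum>\<kappa> | covers \<rho> \<kappa>. num_lvt k \<kappa>) = Stirling (Suc k) (Suc n) * num_syt \<rho>"
      if "covers \<rho> \<mu>" for \<rho>
    proof -
      have \<rho>: "card (diagram \<rho>) = n" using card_diagram_covers[OF that] n by simp
      have "(\<Sum>\<kappa> | covers \<rho> \<kappa>. num_lvt k \<kappa>) = (\<Sum>\<kappa> | covers \<rho> \<kappa>. Stirling k (Suc n) * num_syt \<kappa>)"
        by (rule sum.cong) (auto simp: Suc \<rho> dest: card_diagram_covers)
      also have "\<dots> = Stirling k (Suc n) * (Suc n * num_syt \<rho>)"
        by (simp only: sum_distrib_left[symmetric] sum_num_syt_covers \<rho>)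
      finally show ?thesis by (simp add: Suc \<rho> algebra_simps)
    qed
    then have "num_lvt (Suc k) \<mu> = (\<Sum>\<rho> | covers \<rho> \<mu>. Stirling (Suc k) (Suc n) * num_syt \<rho>)"
      by (simp add: num_lvt_Suc del: Stirling.simps)
    then show ?thesis
      using False by (simp only: sum_distrib_left[symmetric] num_syt_rec[OF False] n)
  qed
qed


section \<open>Semistandard tableaux, one value at a time\<close>

text \<open>
  The content \<open>w\<close> is read only below \<open>N\<close>, so that the same \<open>w\<close> serves throughout an induction on
  \<open>N\<close>.
\<close>

definition ssyt_below :: "nat \<Rightarrow> (nat \<Rightarrow> nat) \<Rightarrow> integer_partition \<Rightarrow> (nat \<times> nat \<Rightarrow> nat) set" where
  "ssyt_below N w \<mu> =
     {T \<in> semistandard_tableaux \<mu>.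
        (\<forall>c\<in>diagram \<mu>. T c < N) \<and> (\<forall>v<N. card {c \<in> diagram \<mu>. T c = v} = w v)}"

lemma finite_ssyt_below: "finite (ssyt_below N w \<mu>)"
proof (rule finite_subset)
  show "finite (diagram \<mu> \<rightarrow>\<^sub>E {..<N})" by (intro finite_PiE) auto
  show "ssyt_below N w \<mu> \<subseteq> diagram \<mu> \<rightarrow>\<^sub>E {..<N}"
    by (rule subsetI) (simp add: ssyt_below_def semistandard_tableaux_def PiE_iff)
qed

lemma card_diagram_ssyt_below:
  assumes "T \<in> ssyt_below N w \<mu>"
  shows "card (diagram \<mu>) = (\<Sum>v<N. w v)"
proof -
  have "(\<Sum>v<N. w v) = (\<Sum>v<N. card {c \<in> diagram \<mu>. T c = v})"
    using assms by (simp add: ssyt_below_def)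
  also have "\<dots> = card (diagram \<mu>)"
    using assms sum.group[of "diagram \<mu>" "{..<N}" T "\<lambda>_. 1 :: nat"]
    by (auto simp: ssyt_below_def)
  finally show ?thesis by simp
qed

text \<open>
  A diagram contains all cells to the left of and above its cells. So it suffices to ask for one of
  the two compared cells to be in the diagram.
\<close>

lemma ssyt_below_iff:
  "T \<in> ssyt_below N w \<mu> \<longleftrightarrow>
     T \<in> extensional (diagram \<mu>) \<and>
     (\<forall>i j j'. (i, j') \<in> diagram \<mu> \<and> j < j' \<longrightarrow> T (i, j) \<le> T (i, j')) \<and>
     (\<forall>i i' j. (i', j) \<in> diagram \<mu> \<and> i < i' \<longrightarrow> T (i, j) < T (i', j)) \<and>
     (\<forall>c\<in>diagram \<mu>. T c < N) \<and> (\<forall>v<N. card {c \<in> diagram \<mu>. T c = v} = w v)"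
proof -
  have ext: "diagram \<mu> \<rightarrow>\<^sub>E UNIV = (extensional (diagram \<mu>) :: (nat \<times> nat \<Rightarrow> nat) set)"
    by (simp add: PiE_def)
  have left: "(i, j) \<in> diagram \<mu>" if "(i, j') \<in> diagram \<mu>" "j < j'" for i j j'
    using diagram_downward[OF that(1) order_refl] that(2) by simp
  have up: "(i, j) \<in> diagram \<mu>" if "(i', j) \<in> diagram \<mu>" "i < i'" for i i' j
    using diagram_downward[OF that(1) _ order_refl] that(2) by simp
  show ?thesis
    unfolding ssyt_below_def semistandard_tableaux_def ext mem_Collect_eq
    using left up by meson
qed

text \<open>
  Tableaux whose values below \<open>N\<close> fill \<open>\<rho>\<close> are recovered from their restriction to \<open>\<rho>\<close> by writing
  \<open>N\<close> into all other cells. The extended filling is strict in the columns because a horizontal strip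
  has at most one cell in each column.
\<close>

lemma card_ssyt_below_slice:
  assumes strip: "hstrip \<rho> \<mu>" and size: "card (diagram \<mu>) = card (diagram \<rho>) + w N"
  shows "card {T \<in> ssyt_below (Suc N) w \<mu>. {c \<in> diagram \<mu>. T c < N} = diagram \<rho>}
       = card (ssyt_below N w \<rho>)"
proof -
  let ?S = "{T \<in> ssyt_below (Suc N) w \<mu>. {c \<in> diagram \<mu>. T c < N} = diagram \<rho>}"
  let ?ext = "\<lambda>U c. if c \<in> diagram \<rho> then U c else if c \<in> diagram \<mu> then N else undefined"
  have sub: "diagram \<rho> \<subseteq> diagram \<mu>" and above: "\<And>i j. (Suc i, j) \<in> diagram \<mu> \<Longrightarrow> (i, j) \<in> diagram \<rho>"
    using strip by (auto simp: hstrip_iff_diagram)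
  have "bij_betw (\<lambda>T. restrict T (diagram \<rho>)) ?S (ssyt_below N w \<rho>)"
  proof (rule bij_betw_byWitness[where f' = ?ext])
    show "\<forall>T\<in>?S. ?ext (restrict T (diagram \<rho>)) = T"
    proof
      fix T assume T: "T \<in> ?S"
      have "T c = N" if "c \<in> diagram \<mu>" "c \<notin> diagram \<rho>" for c
      proof -
        have "T c < Suc N" using T that by (auto simp: ssyt_below_def)
        moreover have "\<not> T c < N" using T that by blast
        ultimately show ?thesis by simp
      qed
      then show "?ext (restrict T (diagram \<rho>)) = T"
        using T by (auto simp: ssyt_below_iff extensional_def fun_eq_iff)
    qed
    show "\<forall>U\<in>ssyt_below N w \<rho>. restrict (?ext U) (diagram \<rho>) = U"
      by (auto simp: ssyt_below_iff extensional_def fun_eq_iff)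
    show "(\<lambda>T. restrict T (diagram \<rho>)) ` ?S \<subseteq> ssyt_below N w \<rho>"
    proof (intro image_subsetI)
      fix T assume T: "T \<in> ?S"
      have count: "{c \<in> diagram \<rho>. restrict T (diagram \<rho>) c = v} = {c \<in> diagram \<mu>. T c = v}"
        if "v < N" for v
        using T that by auto
      have "\<forall>v<N. card {c \<in> diagram \<rho>. restrict T (diagram \<rho>) c = v} = w v"
      proof (intro allI impI)
        fix v assume v: "v < N"
        then show "card {c \<in> diagram \<rho>. restrict T (diagram \<rho>) c = v} = w v"
          unfolding count[OF v] using T by (simp add: ssyt_below_def)
      qed
      then show "restrict T (diagram \<rho>) \<in> ssyt_below N w \<rho>"
        using T sub diagram_downward[of _ _ \<rho>] unfolding ssyt_below_iff
        by (auto dest: less_imp_le)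
    qed
    show "?ext ` ssyt_below N w \<rho> \<subseteq> ?S"
    proof (intro image_subsetI)
      fix U assume U: "U \<in> ssyt_below N w \<rho>"
      then have UN: "U c < N" if "c \<in> diagram \<rho>" for c using that by (auto simp: ssyt_below_def)
      have le_N: "?ext U c \<le> N" if "c \<in> diagram \<mu>" for c
        using UN[of c] that by (simp add: less_imp_le)
      have rows: "?ext U (i, j) \<le> ?ext U (i, j')" if "(i, j') \<in> diagram \<mu>" "j < j'" for i j j'
      proof (cases "(i, j') \<in> diagram \<rho>")
        case True
        then show ?thesis
          using U that diagram_downward[OF True, of i j] by (auto simp: ssyt_below_iff)
      next
        case False
        then show ?thesis
          using that le_N[of "(i, j)"] diagram_downward[OF that(1), of i j] by auto
      qed
      have cols: "?ext U (i, j) < ?ext U (i', j)" if "(i', j) \<in> diagram \<mu>" "i < i'" for i i' j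
      proof (cases "(i', j) \<in> diagram \<rho>")
        case True
        then show ?thesis
          using U that diagram_downward[OF True, of i j] by (auto simp: ssyt_below_iff)
      next
        case False
        have "(i, j) \<in> diagram \<rho>"
          using above diagram_downward[OF that(1), of "Suc i" j] that(2) by simp
        then show ?thesis using False that UN by simp
      qed
      have small: "{c \<in> diagram \<mu>. ?ext U c < N} = diagram \<rho>" using UN sub by auto
      have "card {c \<in> diagram \<mu>. ?ext U c = v} = w v" if "v < Suc N" for v
      proof (cases "v = N")
        case True
        have "{c \<in> diagram \<mu>. ?ext U c = N} = diagram \<mu> - diagram \<rho>"
          using UN sub by force
        then show ?thesis using True size sub by (simp add: card_Diff_subset)
      next
        case False
        then have "{c \<in> diagram \<mu>. ?ext U c = v} = {c \<in> diagram \<rho>. U c = v}"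
          using sub by auto
        then show ?thesis using U that False by (simp add: ssyt_below_def)
      qed
      then show "?ext U \<in> ?S"
        using small rows cols le_N sub
        by (auto simp: ssyt_below_iff extensional_def less_Suc_eq_le)
    qed
  qed
  then show ?thesis by (rule bij_betw_same_card)
qed

lemma card_ssyt_below_Suc:
  "card (ssyt_below (Suc N) w \<mu>) = (\<Sum>\<rho> | \<mu> \<in> strips_above \<rho> (w N). card (ssyt_below N w \<rho>))"
proof -
  let ?R = "{\<rho>. \<mu> \<in> strips_above \<rho> (w N)}"
  let ?slice = "\<lambda>\<rho>. {T \<in> ssyt_below (Suc N) w \<mu>. {c \<in> diagram \<mu>. T c < N} = diagram \<rho>}"
  have fin: "finite ?R"
    by (rule finite_subset[OF _ finite_partitions_le[of "card (diagram \<mu>)"]])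
      (auto simp: strips_above_def)
  have "\<exists>\<rho>\<in>?R. {c \<in> diagram \<mu>. T c < N} = diagram \<rho>" if T: "T \<in> ssyt_below (Suc N) w \<mu>" for T
  proof -
    let ?S = "{c \<in> diagram \<mu>. T c < N}"
    have row: "T (i, j) \<le> T (i, j')" if "(i, j') \<in> diagram \<mu>" "j \<le> j'" for i j j'
      using T that by (cases "j = j'") (auto simp: ssyt_below_iff)
    have col: "T (i, j) < T (i', j)" if "(i', j) \<in> diagram \<mu>" "i < i'" for i i' j
      using T that by (auto simp: ssyt_below_iff)
    have "finite ?S" by simp
    moreover have "(i, j) \<in> ?S" if "(i', j') \<in> ?S" "i \<le> i'" "j \<le> j'" for i j i' j'
    proof -
      have "(i', j) \<in> diagram \<mu>" "(i, j) \<in> diagram \<mu>"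
        using that diagram_downward[of i' j' \<mu>] by auto
      moreover have "T (i', j) \<le> T (i', j')" using that row by simp
      moreover have "T (i, j) \<le> T (i', j)"
        using col[of i' j i] calculation that by (cases "i = i'") auto
      ultimately show ?thesis using that by auto
    qed
    ultimately obtain \<rho> where \<rho>: "diagram \<rho> = ?S" by (rule partition_with_diagram)
    have "(i, j) \<in> diagram \<rho>" if "(Suc i, j) \<in> diagram \<mu>" for i j
    proof -
      have "T (Suc i, j) < Suc N" using T that by (auto simp: ssyt_below_def)
      then show ?thesis
        using col[OF that, of i] diagram_downward[OF that, of i j] by (simp add: \<rho>)
    qed
    then have "hstrip \<rho> \<mu>" by (auto simp: hstrip_iff_diagram \<rho>)
    moreover have "diagram \<mu> - diagram \<rho> = {c \<in> diagram \<mu>. T c = N}"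
      using T by (auto simp: \<rho> ssyt_below_def)
    then have "card (diagram \<mu> - diagram \<rho>) = w N" using T by (simp add: ssyt_below_def)
    moreover have "diagram \<rho> \<subseteq> diagram \<mu>" by (auto simp: \<rho>)
    then have "card (diagram \<mu> - diagram \<rho>) = card (diagram \<mu>) - card (diagram \<rho>)"
      "card (diagram \<rho>) \<le> card (diagram \<mu>)"
      by (simp_all add: card_Diff_subset card_mono)
    ultimately show ?thesis using \<rho> by (auto simp: strips_above_def intro!: exI[of _ \<rho>])
  qed
  then have "ssyt_below (Suc N) w \<mu> = (\<Union>\<rho>\<in>?R. ?slice \<rho>)" by blast
  then have "card (ssyt_below (Suc N) w \<mu>) = card (\<Union>\<rho>\<in>?R. ?slice \<rho>)" by simp
  also have "\<dots> = (\<Sum>\<rho>\<in>?R. card (?slice \<rho>))"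
    by (rule card_UN_disjoint[OF fin]) (auto simp: finite_ssyt_below diagram_inject)
  also have "\<dots> = (\<Sum>\<rho>\<in>?R. card (ssyt_below N w \<rho>))"
    by (rule sum.cong[OF refl]) (auto simp: strips_above_def intro: card_ssyt_below_slice)
  finally show ?thesis .
qed

text \<open>
  The sum on the left is the multinomial coefficient of \<open>w\<close>. It is stated without division, so that
  it can be compared with the coefficient of a power of \<open>h\<^sub>1\<close> by cancelling the product.
\<close>

lemma sum_num_syt_ssyt_below:
  "(\<Sum>\<mu> | card (diagram \<mu>) = (\<Sum>v<N. w v). num_syt \<mu> * card (ssyt_below N w \<mu>)) * (\<Prod>v<N. fact (w v))
     = fact (\<Sum>v<N. w v)"
proof (induction N)
  case 0
  have "{\<mu>. card (diagram \<mu>) = 0} = {empty_partition}"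
    by (simp only: card_diagram_eq_0_iff singleton_conv)
  moreover have "ssyt_below 0 w empty_partition = {\<lambda>_. undefined}"
    by (auto simp: ssyt_below_def semistandard_tableaux_def)
  ultimately show ?case by simp
next
  case (Suc N)
  define n where "n = (\<Sum>v<N. w v)"
  define r where "r = w N"
  let ?P = "\<lambda>n. {\<mu>. card (diagram \<mu>) = n}"
  have "(\<Sum>\<mu>\<in>?P (n + r). num_syt \<mu> * card (ssyt_below (Suc N) w \<mu>))
      = (\<Sum>\<mu>\<in>?P (n + r). \<Sum>\<rho> | \<rho> \<in> ?P n \<and> \<mu> \<in> strips_above \<rho> r. num_syt \<mu> * card (ssyt_below N w \<rho>))"
  proof (rule sum.cong[OF refl])
    fix \<mu> assume \<mu>: "\<mu> \<in> ?P (n + r)"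
    then have "{\<rho>. \<mu> \<in> strips_above \<rho> r} = {\<rho>. \<rho> \<in> ?P n \<and> \<mu> \<in> strips_above \<rho> r}"
      by (auto simp: strips_above_def)
    then show "num_syt \<mu> * card (ssyt_below (Suc N) w \<mu>)
        = (\<Sum>\<rho> | \<rho> \<in> ?P n \<and> \<mu> \<in> strips_above \<rho> r. num_syt \<mu> * card (ssyt_below N w \<rho>))"
      by (simp add: card_ssyt_below_Suc r_def sum_distrib_left)
  qed
  also have "\<dots> = (\<Sum>\<rho>\<in>?P n. \<Sum>\<mu> | \<mu> \<in> ?P (n + r) \<and> \<mu> \<in> strips_above \<rho> r. num_syt \<mu> * card (ssyt_below N w \<rho>))"
    by (rule sum.swap_restrict[OF finite_partitions_card_eq finite_partitions_card_eq])
  also have "\<dots> = (\<Sum>\<rho>\<in>?P n. (n + r choose r) * (num_syt \<rho> * card (ssyt_below N w \<rho>)))"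
  proof (rule sum.cong[OF refl])
    fix \<rho> assume \<rho>: "\<rho> \<in> ?P n"
    then have "{\<mu>. \<mu> \<in> ?P (n + r) \<and> \<mu> \<in> strips_above \<rho> r} = strips_above \<rho> r"
      by (auto simp: strips_above_def)
    then show "(\<Sum>\<mu> | \<mu> \<in> ?P (n + r) \<and> \<mu> \<in> strips_above \<rho> r. num_syt \<mu> * card (ssyt_below N w \<rho>))
        = (n + r choose r) * (num_syt \<rho> * card (ssyt_below N w \<rho>))"
      using \<rho> sum_num_syt_strips_above[of \<rho> r] by (simp add: sum_distrib_right[symmetric])
  qed
  finally have "(\<Sum>\<mu>\<in>?P (n + r). num_syt \<mu> * card (ssyt_below (Suc N) w \<mu>)) * (\<Prod>v<Suc N. fact (w v))
      = (n + r choose r) * fact r * ((\<Sum>\<rho>\<in>?P n. num_syt \<rho> * card (ssyt_below N w \<rho>)) * (\<Prod>v<N. fact (w v)))"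
    by (simp add: sum_distrib_left[symmetric] r_def)
  also have "\<dots> = (n + r choose r) * fact r * fact n" using Suc by (simp add: n_def)
  also have "\<dots> = fact (n + r)"
    using binomial_fact_lemma[of r "n + r"] by (simp add: ac_simps)
  finally show ?case by (simp add: n_def r_def)
qed


section \<open>Powers of the first complete homogeneous function\<close>

lemma coeff_series_sum: "coeff_series (\<Sum>x\<in>A. F x) m = (\<Sum>x\<in>A. coeff_series (F x) m)"
  by (induction A rule: infinite_finite_induct)
    (simp_all add: zero_series.rep_eq plus_series.rep_eq)

lemma coeff_series_of_nat_mult: "coeff_series (of_nat c * F) m = of_nat c * coeff_series F m"
  by (induction c) (simp_all add: zero_series.rep_eq plus_series.rep_eq distrib_right)

lemma add_single_diff:
  fixes m :: "nat \<Rightarrow>\<^sub>0 nat"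
  assumes "i \<in> Poly_Mapping.keys m"
  shows "Poly_Mapping.single i 1 + (m - Poly_Mapping.single i 1) = m"
  using assms
  by (intro poly_mapping_eqI) (auto simp: lookup_add lookup_minus lookup_single when_def in_keys_iff)

lemma coeff_h1_mult:
  "coeff_series (h1 * F) m
     = (\<Sum>i\<in>Poly_Mapping.keys m. coeff_series F (m - Poly_Mapping.single i 1))"
proof -
  let ?pair = "\<lambda>i. (Poly_Mapping.single i (1 :: nat), m - Poly_Mapping.single i 1)"
  have inj: "inj_on ?pair (Poly_Mapping.keys m)"
  proof (rule inj_onI)
    fix i j assume "?pair i = ?pair j"
    then show "i = j" by (metis Pair_inject lookup_single_eq lookup_single_not_eq zero_neq_one)
  qed
  have zero: "coeff_series h1 a * coeff_series F b = 0"
    if "a + b = m" "(a, b) \<notin> ?pair ` Poly_Mapping.keys m" for a b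
  proof -
    have "a \<noteq> Poly_Mapping.single i 1" for i
    proof
      assume a: "a = Poly_Mapping.single i 1"
      then have "Poly_Mapping.lookup m i \<noteq> 0" using that(1) by (auto simp: lookup_add)
      moreover have "b = m - Poly_Mapping.single i 1" using that(1) a by auto
      ultimately show False using that(2) a by (auto simp: in_keys_iff)
    qed
    then show ?thesis by (simp add: coeff_h1)
  qed
  have "coeff_series (h1 * F) m
      = (\<Sum>(a, b)\<in>?pair ` Poly_Mapping.keys m. coeff_series h1 a * coeff_series F b)"
    unfolding times_series.rep_eq
    by (intro sum.mono_neutral_right finite_add_eq) (auto simp: add_single_diff[unfolded One_nat_def] zero)
  also have "\<dots> = (\<Sum>i\<in>Poly_Mapping.keys m. coeff_series F (m - Poly_Mapping.single i 1))"
    by (subst sum.reindex[OF inj]) (auto simp: coeff_h1 intro!: sum.cong)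
  finally show ?thesis .
qed

text \<open>
  The ring need not embed the natural numbers, and division by factorials makes no sense in it. The
  coefficient is therefore described as the image of a natural number \<open>c\<close>, and \<open>c\<close> by an equation
  between natural numbers. In the induction step each variable of \<open>m\<close> contributes the
  coefficient at \<open>m\<close> divided by that variable. If \<open>m\<close> has degree \<open>Suc n\<close>, this becomes \<open>fact n\<close>
  times the exponent of the variable when multiplied by the factorials of \<open>m\<close>, and the exponents
  add up to \<open>Suc n\<close>.
\<close>

lemma coeff_h1_power:
  assumes "Poly_Mapping.keys m \<subseteq> {..<N}"
  shows "\<exists>c. coeff_series (h1 ^ n :: 'a :: comm_ring_1 series) m = of_nat c \<and>
     c * (\<Prod>v<N. fact (Poly_Mapping.lookup m v))
       = (if (\<Sum>v<N. Poly_Mapping.lookup m v) = n then fact n else 0)"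
  using assms
proof (induction n arbitrary: m)
  case 0
  have "(\<Sum>v<N. Poly_Mapping.lookup m v) = 0 \<longleftrightarrow> m = 0"
  proof
    assume "(\<Sum>v<N. Poly_Mapping.lookup m v) = 0"
    then have "\<forall>v<N. Poly_Mapping.lookup m v = 0" by simp
    then have "Poly_Mapping.lookup m v = 0" for v
      using 0 by (cases "v < N") (auto simp: in_keys_iff)
    then show "m = 0" by (simp add: poly_mapping_eqI)
  qed simp
  then show ?case by (intro exI[of _ "if m = 0 then 1 else 0"]) (auto simp: one_series.rep_eq)
next
  case (Suc n)
  let ?l = "Poly_Mapping.lookup" and ?e = "\<lambda>i. Poly_Mapping.single i (1 :: nat)"
  let ?P = "\<lambda>m. \<Prod>v<N. fact (?l m v) :: nat" and ?d = "\<lambda>m. \<Sum>v<N. ?l m v"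
  have "\<forall>i\<in>Poly_Mapping.keys m. \<exists>c. coeff_series (h1 ^ n :: 'a series) (m - ?e i) = of_nat c \<and>
      c * ?P (m - ?e i) = (if ?d (m - ?e i) = n then fact n else 0)"
  proof
    fix i
    have "Poly_Mapping.keys (m - ?e i) \<subseteq> Poly_Mapping.keys m"
      by (auto simp: in_keys_iff lookup_minus)
    then show "\<exists>c. coeff_series (h1 ^ n :: 'a series) (m - ?e i) = of_nat c \<and>
      c * ?P (m - ?e i) = (if ?d (m - ?e i) = n then fact n else 0)"
      using Suc by (meson order_trans)
  qed
  from bchoice[OF this] obtain c where
    c: "\<And>i. i \<in> Poly_Mapping.keys m \<Longrightarrow> coeff_series (h1 ^ n :: 'a series) (m - ?e i) = of_nat (c i)"
      "\<And>i. i \<in> Poly_Mapping.keys m \<Longrightarrow>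
         c i * ?P (m - ?e i) = (if ?d (m - ?e i) = n then fact n else 0)"
    by blast
  have remove: "?P m = ?l m i * ?P (m - ?e i)" "?d m = Suc (?d (m - ?e i))"
    if i: "i \<in> Poly_Mapping.keys m" for i
  proof -
    have iN: "i \<in> {..<N}" using i Suc.prems by blast
    have li: "?l m i = Suc (?l (m - ?e i) i)"
      using i by (simp add: in_keys_iff lookup_minus)
    have other: "?l (m - ?e i) v = ?l m v" if "v \<in> {..<N} - {i}" for v
      using that by (simp add: lookup_minus lookup_single when_def)
    show "?P m = ?l m i * ?P (m - ?e i)"
    proof -
      have "(\<Prod>v\<in>{..<N} - {i}. fact (?l (m - ?e i) v)) = (\<Prod>v\<in>{..<N} - {i}. fact (?l m v) :: nat)"
        by (rule prod.cong) (simp_all only: other)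
      then show ?thesis
        unfolding prod.remove[OF finite_lessThan iN] by (simp add: li algebra_simps)
    qed
    show "?d m = Suc (?d (m - ?e i))"
    proof -
      have "(\<Sum>v\<in>{..<N} - {i}. ?l (m - ?e i) v) = (\<Sum>v\<in>{..<N} - {i}. ?l m v)"
        by (rule sum.cong) (simp_all only: other)
      then show ?thesis
        unfolding sum.remove[OF finite_lessThan iN] by (simp add: li)
    qed
  qed
  have "(\<Sum>i\<in>Poly_Mapping.keys m. c i) * ?P m
      = (\<Sum>i\<in>Poly_Mapping.keys m. ?l m i * (c i * ?P (m - ?e i)))"
    unfolding sum_distrib_right by (rule sum.cong[OF refl]) (simp add: remove(1))
  also have "\<dots> = (\<Sum>i\<in>Poly_Mapping.keys m. ?l m i * (if ?d m = Suc n then fact n else 0))"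
  proof (rule sum.cong[OF refl])
    fix i assume i: "i \<in> Poly_Mapping.keys m"
    show "?l m i * (c i * ?P (m - ?e i)) = ?l m i * (if ?d m = Suc n then fact n else 0)"
      unfolding c(2)[OF i] remove(2)[OF i] by (simp only: nat.inject)
  qed
  also have "\<dots> = ?d m * (if ?d m = Suc n then fact n else 0)"
    unfolding sum_distrib_right[symmetric]
    using Suc.prems by (simp add: sum.mono_neutral_left[of "{..<N}" "Poly_Mapping.keys m"] in_keys_iff)
  also have "\<dots> = (if ?d m = Suc n then fact (Suc n) else 0)" by simp
  finally have "(\<Sum>i\<in>Poly_Mapping.keys m. c i) * ?P m = (if ?d m = Suc n then fact (Suc n) else 0)" .
  moreover have "coeff_series (h1 ^ Suc n :: 'a series) m = of_nat (\<Sum>i\<in>Poly_Mapping.keys m. c i)"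
    by (simp add: coeff_h1_mult c(1)[unfolded One_nat_def])
  ultimately show ?case by blast
qed

lemma coeff_schur:
  assumes "Poly_Mapping.keys m \<subseteq> {..<N}"
  shows "coeff_series (schur \<mu>) m = of_nat (card (ssyt_below N (Poly_Mapping.lookup m) \<mu>))"
proof -
  have "(\<forall>v. card {c \<in> diagram \<mu>. T c = v} = Poly_Mapping.lookup m v) \<longleftrightarrow>
      (\<forall>c\<in>diagram \<mu>. T c < N) \<and> (\<forall>v<N. card {c \<in> diagram \<mu>. T c = v} = Poly_Mapping.lookup m v)"
    (is "?all \<longleftrightarrow> ?below") for T
  proof
    assume all: ?all
    have "T c < N" if "c \<in> diagram \<mu>" for c
    proof -
      have "card {c' \<in> diagram \<mu>. T c' = T c} \<noteq> 0" using that by (cases c) auto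
      then have "T c \<in> Poly_Mapping.keys m" using all by (simp add: in_keys_iff)
      then show ?thesis using assms by blast
    qed
    then show ?below using all by blast
  next
    assume below: ?below
    show ?all
    proof
      fix v
      show "card {c \<in> diagram \<mu>. T c = v} = Poly_Mapping.lookup m v"
      proof (cases "v < N")
        case False
        then have "{c \<in> diagram \<mu>. T c = v} = {}" using below by blast
        moreover have "v \<notin> Poly_Mapping.keys m" using assms False by blast
        ultimately show ?thesis by (simp add: in_keys_iff)
      qed (use below in blast)
    qed
  qed
  then show ?thesis by (simp add: schur.rep_eq ssyt_below_def)
qed

text \<open>
  Both coefficients at a monomial are images of natural numbers that have the same product with the
  factorials of the exponents. In degrees other than \<open>n\<close>, both of these numbers are 0.
\<close>

lemma sum_num_syt_schur:
  "(\<Sum>\<mu> | card (diagram \<mu>) = n. of_nat (num_syt \<mu>) * schur \<mu>) = (h1 ^ n :: 'a :: comm_ring_1 series)"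
proof (rule series_eqI)
  fix m :: "nat \<Rightarrow>\<^sub>0 nat"
  let ?w = "Poly_Mapping.lookup m"
  obtain N where N: "Poly_Mapping.keys m \<subseteq> {..<N}"
  proof -
    have "Poly_Mapping.keys m \<subseteq> {..<Suc (Max (Poly_Mapping.keys m))}"
      by (auto simp: less_Suc_eq_le)
    then show thesis by (rule that)
  qed
  define c where "c = (\<Sum>\<mu> | card (diagram \<mu>) = n. num_syt \<mu> * card (ssyt_below N ?w \<mu>))"
  have "c * (\<Prod>v<N. fact (?w v)) = (if (\<Sum>v<N. ?w v) = n then fact n else 0)"
  proof (cases "(\<Sum>v<N. ?w v) = n")
    case True
    then show ?thesis using sum_num_syt_ssyt_below[of N ?w] by (simp add: c_def)
  next
    case False
    then have "ssyt_below N ?w \<mu> = {}" if "card (diagram \<mu>) = n" for \<mu>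
      using that by (auto dest: card_diagram_ssyt_below)
    then show ?thesis using False by (simp add: c_def)
  qed
  moreover obtain c' where "coeff_series (h1 ^ n :: 'a series) m = of_nat c'"
    "c' * (\<Prod>v<N. fact (?w v)) = (if (\<Sum>v<N. ?w v) = n then fact n else 0)"
    using coeff_h1_power[OF N] by blast
  moreover have "(\<Prod>v<N. fact (?w v)) \<noteq> (0 :: nat)" by simp
  ultimately have "coeff_series (h1 ^ n :: 'a series) m = of_nat c" by (metis mult_cancel2)
  then show "coeff_series (\<Sum>\<mu> | card (diagram \<mu>) = n. of_nat (num_syt \<mu>) * schur \<mu>) m
      = coeff_series (h1 ^ n :: 'a series) m"
    by (simp add: c_def coeff_series_sum coeff_series_of_nat_mult coeff_schur[OF N])
qed

theorem theorem18:
  fixes k :: nat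
  shows "Sum_any (\<lambda>\<mu> :: integer_partition.
             of_nat (num_lvt k \<mu>) * (schur \<mu> :: 'a :: comm_ring_1 series))
         = Sum_any (\<lambda>j :: nat. of_nat (Stirling k j) * h1 ^ j)"
proof -
  let ?P = "\<lambda>j. {\<mu>. card (diagram \<mu>) = j}"
  have "Sum_any (\<lambda>\<mu>. of_nat (num_lvt k \<mu>) * (schur \<mu> :: 'a series))
      = (\<Sum>\<mu> | card (diagram \<mu>) \<le> k. of_nat (num_lvt k \<mu>) * schur \<mu>)"
    by (rule Sum_any.expand_superset[OF finite_partitions_le])
      (auto simp: num_lvt_eq not_le[symmetric] intro: ccontr)
  also have "\<dots> = (\<Sum>j\<le>k. \<Sum>\<mu>\<in>?P j. of_nat (num_lvt k \<mu>) * schur \<mu>)"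
  proof -
    have "{\<mu> \<in> {\<mu>. card (diagram \<mu>) \<le> k}. card (diagram \<mu>) = j} = ?P j" if "j \<le> k" for j
      using that by auto
    then show ?thesis
      by (subst sum.group[OF finite_partitions_le[of k] finite_atMost[of k],
            of "\<lambda>\<mu>. card (diagram \<mu>)", symmetric]) auto
  qed
  also have "\<dots> = (\<Sum>j\<le>k. of_nat (Stirling k j) * h1 ^ j)"
    by (simp add: num_lvt_eq sum_num_syt_schur[symmetric] sum_distrib_left mult.assoc)
  also have "\<dots> = Sum_any (\<lambda>j. of_nat (Stirling k j) * (h1 :: 'a series) ^ j)"
    by (rule Sum_any.expand_superset[symmetric]) (auto simp: not_le[symmetric] intro: ccontr)
  finally show ?thesis .
qed

end
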